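(* Let $1<p<\infty$, let $v$ be a weight function on $\mathbb{R}^2$, and let $\phi\in L^1(\mathbb{R}^2)$ be such that $$\mathscr{A}_{\sup}:=\int_{\mathbb{R}^2} \frac{|\phi(t_1,t_2)|}{|t_1t_2|^{2\alpha+2-\frac1p}}\left(\sup_{(y_1,y_2)\in\mathbb{R}^2}\frac{v(t_1y_1,t_2y_2)}{v(y_1,y_2)}\right)^{1/p}dt_1dt_2<\infty .$$ Then the operator $\mathscr{H}_{\alpha,\phi}:L^p_v(\mathbb{R}^2)\to L^p_v(\mathbb{R}^2)$ is bounded and, for every $f\in L^p_v(\mathbb{R}^2)$, $$\|\mathscr{H}_{\alpha,\phi}f\|_{L^p_v(\mathbb{R}^2)}\le \mathscr{A}_{\sup}\,\|f\|_{L^p_v(\mathbb{R}^2)}.$$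
   Context: A weight function is a function which is measurable, positive and finite almost everywhere on its domain. $L^p_v(\mathbb{R}^2)$ is the weighted Lebesgue space with norm $\|f\|_{L^p_v(\mathbb{R}^2)}=\left(\int_{\mathbb{R}^2}|f(x_1,x_2)|^p v(x_1,x_2)\,dx_1dx_2\right)^{1/p}$. For a real parameter $\alpha$ and $\phi\in L^1(\mathbb{R}^2)$, the two dimensional Dunkl-Hausdorff operator is $$\mathscr{H}_{\alpha,\phi}f(x_1,x_2)=\int_{\mathbb{R}^2}\frac{|\phi(t_1,t_2)|}{|t_1t_2|^{2\alpha+2}}f\left(\frac{x_1}{t_1},\frac{x_2}{t_2}\right)dt_1dt_2 .$$ *)

theory Defs
  imports "HOL-Analysis.Analysis"
begin

text \<open>Measurability and null sets refer to Lebesgue measure on the plane. A weight takes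
  values in the extended half-line and may be zero or infinite on a null set only.\<close>

definition weight_function :: "(real \<times> real \<Rightarrow> ennreal) \<Rightarrow> bool" where
  "weight_function v \<longleftrightarrow>
     v \<in> borel_measurable lebesgue \<and> (AE x in lebesgue. 0 < v x \<and> v x < \<infinity>)"

text \<open>Power of an extended nonnegative number; used for exponents \<open>r > 0\<close> only.\<close>

definition ennreal_powr :: "ennreal \<Rightarrow> real \<Rightarrow> ennreal" where
  "ennreal_powr a r = (if a = \<infinity> then \<infinity> else ennreal (enn2real a powr r))"

definition Lp_norm ::
  "real \<Rightarrow> (real \<times> real \<Rightarrow> ennreal) \<Rightarrow> (real \<times> real \<Rightarrow> complex) \<Rightarrow> ennreal" where
  "Lp_norm p v f =
     ennreal_powr (\<integral>\<^sup>+x. ennreal (cmod (f x) powr p) * v x \<partial>lebesgue) (1 / p)"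

text \<open>Elements are functions, not equivalence classes; identification almost everywhere is
  dealt with explicitly in \<open>bounded_operator_Lp\<close>.\<close>

definition Lp_space ::
  "real \<Rightarrow> (real \<times> real \<Rightarrow> ennreal) \<Rightarrow> (real \<times> real \<Rightarrow> complex) set" where
  "Lp_space p v = {f. f \<in> borel_measurable lebesgue \<and> Lp_norm p v f < \<infinity>}"

definition dunkl_hausdorff_integrand ::
  "real \<Rightarrow> (real \<times> real \<Rightarrow> complex) \<Rightarrow> (real \<times> real \<Rightarrow> complex) \<Rightarrow>
     real \<times> real \<Rightarrow> real \<times> real \<Rightarrow> complex" where
  "dunkl_hausdorff_integrand \<alpha> \<phi> f = (\<lambda>(x1, x2) (t1, t2).
     of_real (cmod (\<phi> (t1, t2)) / \<bar>t1 * t2\<bar> powr (2 * \<alpha> + 2)) * f (x1 / t1, x2 / t2))"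

definition dunkl_hausdorff ::
  "real \<Rightarrow> (real \<times> real \<Rightarrow> complex) \<Rightarrow> (real \<times> real \<Rightarrow> complex) \<Rightarrow> real \<times> real \<Rightarrow> complex" where
  "dunkl_hausdorff \<alpha> \<phi> f x = (LINT t|lebesgue. dunkl_hausdorff_integrand \<alpha> \<phi> f x t)"

text \<open>The supremum is the pointwise one over the whole plane. In \<open>ennreal\<close>, a quotient
  \<open>a / 0\<close> with \<open>a > 0\<close> is infinite, while \<open>0 / 0\<close> and \<open>\<infinity> / \<infinity>\<close> are \<open>0\<close>, so that indeterminate
  quotients (which occur for almost no \<open>y\<close>) do not contribute. If the integrand is not
  measurable, \<open>nn_integral\<close> is the lower integral.\<close>

definition A_sup ::
  "real \<Rightarrow> real \<Rightarrow> (real \<times> real \<Rightarrow> ennreal) \<Rightarrow> (real \<times> real \<Rightarrow> complex) \<Rightarrow> ennreal" where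
  "A_sup \<alpha> p v \<phi> =
     (\<integral>\<^sup>+(t1, t2). ennreal (cmod (\<phi> (t1, t2)) / \<bar>t1 * t2\<bar> powr (2 * \<alpha> + 2 - 1 / p)) *
        ennreal_powr (SUP (y1, y2) \<in> UNIV. v (t1 * y1, t2 * y2) / v (y1, y2)) (1 / p)
      \<partial>lebesgue)"

text \<open>\<open>T\<close> induces a bounded linear operator on the space of almost-everywhere classes.\<close>

definition bounded_operator_Lp ::
  "real \<Rightarrow> (real \<times> real \<Rightarrow> ennreal) \<Rightarrow>
     ((real \<times> real \<Rightarrow> complex) \<Rightarrow> real \<times> real \<Rightarrow> complex) \<Rightarrow> bool" where
  "bounded_operator_Lp p v T \<longleftrightarrow>
     (\<forall>f \<in> Lp_space p v. T f \<in> Lp_space p v) \<and>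
     (\<forall>f \<in> Lp_space p v. \<forall>g \<in> Lp_space p v.
        (AE x in lebesgue. f x = g x) \<longrightarrow> (AE x in lebesgue. T f x = T g x)) \<and>
     (\<forall>f \<in> Lp_space p v. \<forall>g \<in> Lp_space p v.
        AE x in lebesgue. T (\<lambda>y. f y + g y) x = T f x + T g x) \<and>
     (\<forall>c. \<forall>f \<in> Lp_space p v. AE x in lebesgue. T (\<lambda>y. c * f y) x = c * T f x) \<and>
     (\<exists>C \<ge> 0. \<forall>f \<in> Lp_space p v. Lp_norm p v (T f) \<le> ennreal C * Lp_norm p v f)"

end

theory Submission
  imports Defs
begin

text \<open>
  Write \<open>x / t\<close> for the coordinatewise quotient. The operator is a superposition of the
  dilations \<open>f \<mapsto> f (_ / t)\<close> with nonnegative coefficients. Substituting \<open>x = (t1 * y1, t2 * y2)\<close>,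

  \<open>\<integral> \<bar>f (x / t)\<bar> powr p * v x dx = \<bar>t1 * t2\<bar> * \<integral> \<bar>f y\<bar> powr p * v (t1 * y1, t2 * y2) dy\<close>,

  and the last weight is at most \<open>sup_z (v (t1 * z1, t2 * z2) / v z)\<close> times \<open>v y\<close>, for almost
  every \<open>y\<close>. So the \<open>t\<close>-th dilation times its coefficient has operator norm at most the
  integrand of \<open>A_sup\<close> at \<open>t\<close>, and Minkowski's integral inequality adds these norms up
  (\<open>multiplicative_convolution_bound\<close>). Applied to the integrand in absolute value, the same
  estimate shows that the integral defining the operator converges almost everywhere.

  Minkowski's inequality (\<open>Minkowski_nn_integral\<close>) is deduced from a weighted form of Hoelder's
  inequality, the weight being the norm of each slice of the integrand.

  Two points of measure theory need care. All functions are Lebesgue measurable only, and are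
  replaced by Borel versions before Fubini's theorem is used; this is harmless because
  \<open>x \<mapsto> t * x\<close> and \<open>t \<mapsto> x / t\<close> pull null sets back to null sets (\<open>AE_dilate\<close>,
  \<open>AE_coord_divide\<close>). And the supremum need not be measurable in \<open>t\<close>, so that \<open>A_sup\<close> may be
  a lower integral; but the norm of the dilated function is measurable in \<open>t\<close> and lies below its
  integrand, up to a constant factor (\<open>nn_integral_le_lower_integral\<close>).
\<close>

section \<open>Powers of extended nonnegative numbers\<close>

lemma ennreal_powr_ennreal: "0 \<le> a \<Longrightarrow> ennreal_powr (ennreal a) r = ennreal (a powr r)"
  by (simp add: ennreal_powr_def)

lemma ennreal_powr_top [simp]: "ennreal_powr top r = top"
  by (simp add: ennreal_powr_def)

lemma ennreal_powr_0 [simp]: "ennreal_powr 0 r = 0"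
  by (simp add: ennreal_powr_def)

lemma ennreal_powr_eq_0_iff [simp]: "ennreal_powr a r = 0 \<longleftrightarrow> a = 0"
  by (cases a) (auto simp: ennreal_powr_ennreal)

lemma ennreal_powr_eq_top_iff [simp]: "ennreal_powr a r = top \<longleftrightarrow> a = top"
  by (cases a) (auto simp: ennreal_powr_ennreal)

lemma ennreal_powr_less_top_iff [simp]: "ennreal_powr a r < top \<longleftrightarrow> a < top"
  by (simp add: less_top[symmetric])

lemma ennreal_powr_mono: "a \<le> b \<Longrightarrow> 0 < r \<Longrightarrow> ennreal_powr a r \<le> ennreal_powr b r"
  by (cases a; cases b) (auto simp: ennreal_powr_ennreal top_unique intro!: ennreal_leI powr_mono2)

lemma ennreal_powr_mult: "ennreal_powr (a * b) r = ennreal_powr a r * ennreal_powr b r"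
proof (cases "a = 0 \<or> b = 0 \<or> a = top \<or> b = top")
  case True
  then show ?thesis by (auto simp: ennreal_mult_top ennreal_top_mult)
next
  case False
  then show ?thesis
    by (cases a; cases b) (auto simp: ennreal_powr_ennreal ennreal_mult[symmetric] powr_mult)
qed

lemma ennreal_powr_powr: "ennreal_powr (ennreal_powr a r) s = ennreal_powr a (r * s)"
  by (cases a) (auto simp: ennreal_powr_ennreal powr_powr)

lemma ennreal_powr_1 [simp]: "ennreal_powr a 1 = a"
  by (cases a) (auto simp: ennreal_powr_ennreal)

lemma measurable_ennreal_powr [measurable]:
  assumes [measurable]: "f \<in> borel_measurable M"
  shows "(\<lambda>x. ennreal_powr (f x) r) \<in> borel_measurable M"
  unfolding ennreal_powr_def by measurable

section \<open>Minkowski's integral inequality\<close>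

text \<open>The graph of \<open>a \<mapsto> a powr p\<close> lies above its tangent at \<open>c\<close>; this is Young's
  inequality for \<open>a\<close> and \<open>c powr (p - 1)\<close>.\<close>

lemma Young_tangent:
  fixes a c p :: real
  assumes "1 < p" "0 \<le> a" "0 \<le> c"
  shows "p * c powr (p - 1) * a \<le> a powr p + (p - 1) * c powr p"
proof -
  define q where "q = p / (p - 1)"
  have q: "1 < q" "1 / p + 1 / q = 1" "(p - 1) * q = p" "p / q = p - 1"
    using assms by (simp_all add: q_def field_simps)
  have "a * c powr (p - 1) \<le> a powr p / p + (c powr (p - 1)) powr q / q"
    using assms q by (intro Youngs_inequality) auto
  also have "\<dots> = a powr p / p + c powr p / q"
    by (simp add: powr_powr q)
  finally have "p * (a * c powr (p - 1)) \<le> p * (a powr p / p + c powr p / q)"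
    using assms by (intro mult_left_mono) auto
  also have "\<dots> = a powr p + (p / q) * c powr p"
    using assms by (simp add: field_simps)
  finally show ?thesis by (simp add: q mult_ac)
qed

text \<open>The tangent inequality at \<open>a / w\<close>, multiplied by \<open>w\<close>. For \<open>w = 0\<close> the quotient on the
  right-hand side is infinite unless \<open>a = 0\<close>.\<close>

lemma Young_tangent_weighted:
  fixes c p :: real and a w :: ennreal
  assumes p: "1 < p" and c: "0 \<le> c" and w: "w < top"
  shows "ennreal (p * c powr (p - 1)) * a
    \<le> ennreal_powr a p / ennreal_powr w (p - 1) + ennreal ((p - 1) * c powr p) * w"
proof (cases "a = 0 \<or> w = 0 \<or> a = top")
  case True
  with w p show ?thesis
    by (cases "a = 0") (auto simp: ennreal_divide_eq_top_iff ennreal_top_divide)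
next
  case False
  with w obtain A W where AW: "a = ennreal A" "0 \<le> A" "w = ennreal W" "0 < W"
    by (cases a; cases w) (auto simp: order_le_less)
  have "p * c powr (p - 1) * (A / W) \<le> (A / W) powr p + (p - 1) * c powr p"
    using AW p c by (intro Young_tangent) auto
  then have "p * c powr (p - 1) * (A / W) * W \<le> ((A / W) powr p + (p - 1) * c powr p) * W"
    using AW by (intro mult_right_mono) auto
  then have "p * c powr (p - 1) * A \<le> (A / W) powr p * W + (p - 1) * c powr p * W"
    using AW by (simp add: distrib_right)
  also have "(A / W) powr p * W = A powr p / W powr (p - 1)"
    using AW by (simp add: powr_divide powr_diff)
  finally have "ennreal (p * c powr (p - 1) * A)
      \<le> ennreal (A powr p / W powr (p - 1) + (p - 1) * c powr p * W)"
    by (rule ennreal_leI)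
  then show ?thesis
    using AW p by (simp add: ennreal_powr_ennreal ennreal_mult divide_ennreal ennreal_plus)
qed

text \<open>Hoelder's inequality for the factorization \<open>f = (f / w powr (1 - 1 / p)) * w powr (1 - 1 / p)\<close>, or,
  in other words, Jensen's inequality for the density \<open>f / w\<close> with respect to the finite measure
  with density \<open>w\<close>. Integrating the tangent inequality gives one linear bound for each tangent
  point \<open>c\<close>; the best \<open>c\<close> is the mean value of \<open>f / w\<close>, namely \<open>U / A\<close> below.\<close>

lemma nn_integral_powr_le_weighted:
  fixes f w :: "'a \<Rightarrow> ennreal" and p :: real
  assumes p: "1 < p"
    and [measurable]: "f \<in> borel_measurable M" "w \<in> borel_measurable M"
    and fin: "(\<integral>\<^sup>+t. w t \<partial>M) < top"
    and zero: "AE t in M. w t = 0 \<longrightarrow> f t = 0"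
  shows "ennreal_powr (\<integral>\<^sup>+t. f t \<partial>M) p
    \<le> ennreal_powr (\<integral>\<^sup>+t. w t \<partial>M) (p - 1)
        * (\<integral>\<^sup>+t. ennreal_powr (f t) p / ennreal_powr (w t) (p - 1) \<partial>M)"
proof -
  define U where "U = (\<integral>\<^sup>+t. f t \<partial>M)"
  define A where "A = (\<integral>\<^sup>+t. w t \<partial>M)"
  define B where "B = (\<integral>\<^sup>+t. ennreal_powr (f t) p / ennreal_powr (w t) (p - 1) \<partial>M)"
  have wfin: "AE t in M. w t < top"
    using nn_integral_PInf_AE[of w M] fin by (auto simp: less_top)
  have tangent: "ennreal (p * c powr (p - 1)) * U \<le> B + ennreal ((p - 1) * c powr p) * A"
    if "0 \<le> c" for c
  proof -
    have "ennreal (p * c powr (p - 1)) * U = (\<integral>\<^sup>+t. ennreal (p * c powr (p - 1)) * f t \<partial>M)"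
      unfolding U_def by (simp add: nn_integral_cmult)
    also have "\<dots> \<le> (\<integral>\<^sup>+t. ennreal_powr (f t) p / ennreal_powr (w t) (p - 1)
        + ennreal ((p - 1) * c powr p) * w t \<partial>M)"
      using wfin
      by (intro nn_integral_mono_AE, eventually_elim) (auto intro!: Young_tangent_weighted p that)
    also have "\<dots> = B + ennreal ((p - 1) * c powr p) * A"
      unfolding A_def B_def by (simp add: nn_integral_add nn_integral_cmult)
    finally show ?thesis .
  qed
  have "ennreal_powr U p \<le> ennreal_powr A (p - 1) * B"
  proof (cases "A = 0")
    case True
    then have "AE t in M. w t = 0"
      unfolding A_def by (simp add: nn_integral_0_iff_AE)
    with zero have "AE t in M. f t = 0" by eventually_elim simp
    then have "U = 0" unfolding U_def by (simp add: nn_integral_0_iff_AE)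
    then show ?thesis by simp
  next
    case A0: False
    show ?thesis
    proof (cases "B = top")
      case True
      with A0 show ?thesis by (simp add: ennreal_mult_top)
    next
      case False
      \<comment> \<open>The tangent at \<open>1\<close> shows that \<open>U\<close> is finite, so that \<open>U / A\<close> is a legitimate
        tangent point.\<close>
      have "ennreal p * U \<le> B + ennreal (p - 1) * A" using tangent[of 1] by simp
      also have "\<dots> < top" using False fin by (simp add: A_def ennreal_mult_less_top less_top)
      finally have "U \<noteq> top" using p by (auto simp: ennreal_mult_top)
      with A0 False fin obtain u a b where r: "U = ennreal u" "0 \<le> u" "A = ennreal a" "0 < a"
          "B = ennreal b" "0 \<le> b"
        unfolding A_def[symmetric] by (cases U; cases A; cases B) (auto simp: order_le_less)
      have "ennreal (p * (u / a) powr (p - 1) * u) \<le> ennreal (b + (p - 1) * (u / a) powr p * a)"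
        using tangent[of "u / a"] r p by (simp add: ennreal_mult ennreal_plus)
      then have *: "p * (u / a) powr (p - 1) * u \<le> b + (p - 1) * (u / a) powr p * a"
        using r p by (subst (asm) ennreal_le_iff) auto
      have "(u / a) powr (p - 1) * u = u powr p / a powr (p - 1)"
        using r by (cases "u = 0") (auto simp: powr_divide powr_diff)
      moreover have "(u / a) powr p * a = u powr p / a powr (p - 1)"
        using r by (simp add: powr_divide powr_diff)
      ultimately have "p * (u powr p / a powr (p - 1)) \<le> b + (p - 1) * (u powr p / a powr (p - 1))"
        using * by (simp only: mult.assoc)
      then have "u powr p / a powr (p - 1) \<le> b" by (simp only: left_diff_distrib mult_1)
      then have "u powr p \<le> a powr (p - 1) * b"
        using r by (simp add: field_simps)
      then show ?thesis
        using r by (simp add: ennreal_powr_ennreal ennreal_mult[symmetric])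
    qed
  qed
  then show ?thesis by (simp add: U_def A_def B_def)
qed

lemma ennreal_powr_divide_self:
  fixes a :: ennreal
  assumes "1 < p"
  shows "ennreal_powr a p / ennreal_powr a (p - 1) \<le> a"
proof (cases "a = 0 \<or> a = top")
  case False
  then show ?thesis
    by (cases a) (auto simp: ennreal_powr_ennreal divide_ennreal powr_diff)
qed auto

text \<open>Let \<open>w t\<close> be the \<open>p\<close>-norm of \<open>F _ t\<close>. For fixed \<open>x\<close> the weighted bound above
  controls the \<open>p\<close>-th power of the inner integral by \<open>A powr (p - 1)\<close> times the integral of
  \<open>F x t powr p / w t powr (p - 1)\<close>, where \<open>A\<close> is the integral of \<open>w\<close>. Integrating over \<open>x\<close>
  and exchanging the integrals turns the numerator into \<open>w t powr p\<close>, so that \<open>A powr p\<close>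
  remains. This choice of weight avoids the usual duality argument, in which one has to
  truncate \<open>F\<close> in order to divide by a finite norm.\<close>

lemma Minkowski_nn_integral:
  fixes F :: "'a \<Rightarrow> 'b \<Rightarrow> ennreal" and p :: real
  assumes p: "1 < p" and M: "sigma_finite_measure M" and N: "sigma_finite_measure N"
    and F [measurable]: "case_prod F \<in> borel_measurable (M \<Otimes>\<^sub>M N)"
  shows "(\<integral>\<^sup>+x. ennreal_powr (\<integral>\<^sup>+t. F x t \<partial>N) p \<partial>M)
    \<le> ennreal_powr (\<integral>\<^sup>+t. ennreal_powr (\<integral>\<^sup>+x. ennreal_powr (F x t) p \<partial>M) (1 / p) \<partial>N) p"
proof -
  interpret M: sigma_finite_measure M by (fact M)
  interpret N: sigma_finite_measure N by (fact N)
  interpret pair_sigma_finite M N ..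
  define w where "w t = ennreal_powr (\<integral>\<^sup>+x. ennreal_powr (F x t) p \<partial>M) (1 / p)" for t
  define A where "A = (\<integral>\<^sup>+t. w t \<partial>N)"
  have w [measurable]: "w \<in> borel_measurable N" unfolding w_def by measurable
  have w_powr: "ennreal_powr (w t) p = (\<integral>\<^sup>+x. ennreal_powr (F x t) p \<partial>M)" for t
    using p by (simp add: w_def ennreal_powr_powr)
  show ?thesis
  proof (cases "A = top")
    case True
    then show ?thesis by (simp add: A_def w_def)
  next
    case False
    \<comment> \<open>Where the norm \<open>w t\<close> vanishes, so does almost all of \<open>F _ t\<close>; by Fubini the
      exceptional set can be seen from the other variable.\<close>
    have "AE t in N. AE x in M. w t = 0 \<longrightarrow> F x t = 0"
    proof (rule AE_I2)
      fix t assume [measurable]: "t \<in> space N"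
      show "AE x in M. w t = 0 \<longrightarrow> F x t = 0"
      proof (cases "w t = 0")
        case True
        then have "(\<integral>\<^sup>+x. ennreal_powr (F x t) p \<partial>M) = 0" by (simp flip: w_powr)
        then show ?thesis by (subst (asm) nn_integral_0_iff_AE) auto
      qed simp
    qed
    then have "AE x in M. AE t in N. w t = 0 \<longrightarrow> F x t = 0"
      by (subst AE_commute) auto
    with AE_space have "AE x in M. ennreal_powr (\<integral>\<^sup>+t. F x t \<partial>N) p
      \<le> ennreal_powr A (p - 1) * (\<integral>\<^sup>+t. ennreal_powr (F x t) p / ennreal_powr (w t) (p - 1) \<partial>N)"
    proof eventually_elim
      case (elim x)
      then have [measurable]: "x \<in> space M" by simp
      show ?case
        unfolding A_def
      proof (rule nn_integral_powr_le_weighted[OF p _ w])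
        show "(\<integral>\<^sup>+t. w t \<partial>N) < top" using False by (simp add: A_def less_top)
      qed (use elim in simp_all)
    qed
    then have "(\<integral>\<^sup>+x. ennreal_powr (\<integral>\<^sup>+t. F x t \<partial>N) p \<partial>M)
      \<le> (\<integral>\<^sup>+x. ennreal_powr A (p - 1)
            * (\<integral>\<^sup>+t. ennreal_powr (F x t) p / ennreal_powr (w t) (p - 1) \<partial>N) \<partial>M)"
      by (rule nn_integral_mono_AE)
    also have "\<dots> = ennreal_powr A (p - 1)
        * (\<integral>\<^sup>+x. \<integral>\<^sup>+t. ennreal_powr (F x t) p / ennreal_powr (w t) (p - 1) \<partial>N \<partial>M)"
      by (simp add: nn_integral_cmult)
    also have "(\<integral>\<^sup>+x. \<integral>\<^sup>+t. ennreal_powr (F x t) p / ennreal_powr (w t) (p - 1) \<partial>N \<partial>M)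
        = (\<integral>\<^sup>+t. \<integral>\<^sup>+x. ennreal_powr (F x t) p / ennreal_powr (w t) (p - 1) \<partial>M \<partial>N)"
      by (rule Fubini'[symmetric]) measurable
    also have "\<dots> = (\<integral>\<^sup>+t. ennreal_powr (w t) p / ennreal_powr (w t) (p - 1) \<partial>N)"
      by (intro nn_integral_cong) (simp add: w_powr nn_integral_divide)
    also have "\<dots> \<le> A"
      unfolding A_def by (intro nn_integral_mono ennreal_powr_divide_self p)
    finally have "(\<integral>\<^sup>+x. ennreal_powr (\<integral>\<^sup>+t. F x t \<partial>N) p \<partial>M) \<le> ennreal_powr A (p - 1) * A"
      by (simp add: mult_left_mono)
    also have "ennreal_powr A (p - 1) * A = ennreal_powr A p"
      using False p by (cases A) (auto simp: ennreal_powr_ennreal ennreal_mult[symmetric] powr_diff)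
    finally show ?thesis by (simp add: A_def w_def)
  qed
qed

section \<open>Coordinatewise dilations and quotients\<close>

text \<open>The points \<open>x\<close> at which \<open>P (g x)\<close> fails are images under the local inverse \<open>h\<close> of points
  at which \<open>P\<close> fails, and differentiable maps carry null sets to null sets.\<close>

lemma AE_lebesgue_comp:
  fixes g h :: "'a::euclidean_space \<Rightarrow> 'a"
  assumes P: "AE y in lebesgue. P y"
    and g: "AE x in lebesgue. g x \<in> U \<and> h (g x) = x"
    and h: "h differentiable_on U"
  shows "AE x in lebesgue. P (g x)"
proof -
  obtain A where A: "negligible A" "{y. \<not> P y} \<subseteq> A"
    using P by (auto simp: eventually_ae_filter negligible_iff_null_sets)
  obtain B where B: "negligible B" "{x. \<not> (g x \<in> U \<and> h (g x) = x)} \<subseteq> B"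
    using g by (auto simp: eventually_ae_filter negligible_iff_null_sets)
  have "negligible (h ` (U \<inter> A))"
    using A h by (intro negligible_differentiable_image_negligible)
      (auto intro: negligible_subset differentiable_on_subset)
  with B have "negligible (B \<union> h ` (U \<inter> A))" by simp
  moreover have "{x. \<not> P (g x)} \<subseteq> B \<union> h ` (U \<inter> A)"
  proof
    fix x assume "x \<in> {x. \<not> P (g x)}"
    with A have "g x \<in> A" by auto
    then show "x \<in> B \<union> h ` (U \<inter> A)"
      using B by (cases "x \<in> B") (force intro!: image_eqI[of _ _ "g x"])+
  qed
  ultimately show ?thesis
    by (auto simp: eventually_ae_filter negligible_iff_null_sets)
qed

lemma AE_off_axes: "AE x in lebesgue. fst x \<noteq> 0 \<and> snd (x :: real \<times> real) \<noteq> 0"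
proof -
  have "negligible ({x :: real \<times> real. x \<bullet> (1, 0) = 0} \<union> {x. x \<bullet> (0, 1) = 0})"
    by (intro negligible_Un negligible_standard_hyperplane) (auto simp: Basis_prod_def)
  then show ?thesis
    unfolding eventually_ae_filter negligible_iff_null_sets
    by (rule bexI[rotated]) (auto simp: inner_prod_def)
qed

definition dilate :: "real \<times> real \<Rightarrow> real \<times> real \<Rightarrow> real \<times> real" where
  "dilate t y = (fst t * fst y, snd t * snd y)"

definition coord_divide :: "real \<times> real \<Rightarrow> real \<times> real \<Rightarrow> real \<times> real" where
  "coord_divide x t = (fst x / fst t, snd x / snd t)"

lemma measurable_dilate [measurable]:
  assumes "f \<in> M \<rightarrow>\<^sub>M borel" "g \<in> M \<rightarrow>\<^sub>M borel"
  shows "(\<lambda>x. dilate (f x) (g x)) \<in> M \<rightarrow>\<^sub>M borel"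
proof -
  have [measurable]: "f \<in> M \<rightarrow>\<^sub>M borel \<Otimes>\<^sub>M borel" "g \<in> M \<rightarrow>\<^sub>M borel \<Otimes>\<^sub>M borel"
    using assms by (simp_all add: borel_prod)
  show ?thesis
    unfolding dilate_def borel_prod[symmetric] by measurable
qed

lemma measurable_coord_divide [measurable]:
  assumes "f \<in> M \<rightarrow>\<^sub>M borel" "g \<in> M \<rightarrow>\<^sub>M borel"
  shows "(\<lambda>x. coord_divide (f x) (g x)) \<in> M \<rightarrow>\<^sub>M borel"
proof -
  have [measurable]: "f \<in> M \<rightarrow>\<^sub>M borel \<Otimes>\<^sub>M borel" "g \<in> M \<rightarrow>\<^sub>M borel \<Otimes>\<^sub>M borel"
    using assms by (simp_all add: borel_prod)
  show ?thesis
    unfolding coord_divide_def borel_prod[symmetric] by measurable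
qed

lemma coord_divide_dilate: "fst t \<noteq> 0 \<Longrightarrow> snd t \<noteq> 0 \<Longrightarrow> coord_divide (dilate t y) t = y"
  by (simp add: coord_divide_def dilate_def)

lemma AE_dilate:
  assumes "AE y in lebesgue. P y" and t: "fst t \<noteq> 0" "snd t \<noteq> 0"
  shows "AE y in lebesgue. P (dilate t y)"
proof (rule AE_lebesgue_comp[where U = UNIV and h = "\<lambda>x. coord_divide x t"])
  show "(\<lambda>x. coord_divide x t) differentiable_on UNIV"
    unfolding coord_divide_def differentiable_on_def differentiable_def
    using t by (auto intro!: exI derivative_eq_intros)
qed (use assms in \<open>auto simp: coord_divide_dilate\<close>)

text \<open>On the complement of the axes, \<open>coord_divide x\<close> is a differentiable involution.\<close>

lemma AE_coord_divide:
  assumes "AE y in lebesgue. P y" and x: "fst x \<noteq> 0" "snd x \<noteq> 0"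
  shows "AE t in lebesgue. P (coord_divide x t)"
proof (rule AE_lebesgue_comp[where U = "{y. fst y \<noteq> 0 \<and> snd y \<noteq> 0}" and h = "coord_divide x"])
  show "AE t in lebesgue. coord_divide x t \<in> {y. fst y \<noteq> 0 \<and> snd y \<noteq> 0} \<and> coord_divide x (coord_divide x t) = t"
    using AE_off_axes by eventually_elim (use x in \<open>auto simp: coord_divide_def prod_eq_iff\<close>)
  show "coord_divide x differentiable_on {y. fst y \<noteq> 0 \<and> snd y \<noteq> 0}"
    unfolding coord_divide_def[abs_def] differentiable_on_def differentiable_def
    by (auto intro!: exI derivative_eq_intros)
qed fact

lemma nn_integral_dilate:
  fixes g :: "real \<times> real \<Rightarrow> ennreal"
  assumes [measurable]: "g \<in> borel_measurable borel" and t: "fst t \<noteq> 0" "snd t \<noteq> 0"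
  shows "(\<integral>\<^sup>+x. g x \<partial>lborel) = ennreal \<bar>fst t * snd t\<bar> * (\<integral>\<^sup>+y. g (dilate t y) \<partial>lborel)"
proof -
  have [measurable]: "g \<in> borel_measurable (borel \<Otimes>\<^sub>M borel)" by (simp add: borel_prod)
  have "(\<integral>\<^sup>+x. g x \<partial>lborel) = (\<integral>\<^sup>+a. \<integral>\<^sup>+b. g (a, b) \<partial>lborel \<partial>lborel)"
    by (subst lborel_prod[symmetric], subst lborel.nn_integral_fst[symmetric]) auto
  also have "\<dots> = ennreal \<bar>fst t\<bar> * (\<integral>\<^sup>+a. \<integral>\<^sup>+b. g (0 + fst t * a, b) \<partial>lborel \<partial>lborel)"
    using t by (intro nn_integral_real_affine) simp_all
  also have "(\<integral>\<^sup>+a. \<integral>\<^sup>+b. g (0 + fst t * a, b) \<partial>lborel \<partial>lborel)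
      = (\<integral>\<^sup>+a. ennreal \<bar>snd t\<bar> * (\<integral>\<^sup>+b. g (0 + fst t * a, 0 + snd t * b) \<partial>lborel) \<partial>lborel)"
    using t by (intro nn_integral_cong nn_integral_real_affine) simp_all
  also have "\<dots> = ennreal \<bar>snd t\<bar> * (\<integral>\<^sup>+a. \<integral>\<^sup>+b. g (dilate t (a, b)) \<partial>lborel \<partial>lborel)"
    by (simp add: nn_integral_cmult dilate_def)
  also have "(\<integral>\<^sup>+a. \<integral>\<^sup>+b. g (dilate t (a, b)) \<partial>lborel \<partial>lborel) = (\<integral>\<^sup>+y. g (dilate t y) \<partial>lborel)"
    by (subst lborel_prod[symmetric], subst lborel.nn_integral_fst[symmetric])
      (simp_all add: lborel_prod)
  finally show ?thesis by (simp add: abs_mult ennreal_mult mult.assoc)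
qed

text \<open>The quantity whose \<open>1 / p\<close>-th power enters \<open>A_sup\<close>. As a supremum of uncountably many
  functions of \<open>t\<close> it may fail to be measurable.\<close>

definition dilation_ratio :: "(real \<times> real \<Rightarrow> ennreal) \<Rightarrow> real \<times> real \<Rightarrow> ennreal" where
  "dilation_ratio v t = (SUP y. v (dilate t y) / v y)"

lemma weight_dilate_le:
  assumes "0 < v y" "v y < top"
  shows "v (dilate t y) \<le> dilation_ratio v t * v y"
proof -
  have "v (dilate t y) = v (dilate t y) / v y * v y"
    using assms by (simp add: ennreal_divide_times ennreal_times_divide)
  also have "\<dots> \<le> dilation_ratio v t * v y"
    unfolding dilation_ratio_def by (intro mult_right_mono SUP_upper) auto
  finally show ?thesis .
qed

text \<open>Substituting \<open>x = dilate t y\<close> moves the dilation from \<open>g\<close> to the weight, where it costs at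
  most the dilation ratio. A Borel version \<open>u\<close> of \<open>v\<close> makes the substitution possible; it may
  replace \<open>v\<close> on both sides because dilations preserve null sets.\<close>

lemma nn_integral_coord_divide_le:
  assumes v: "weight_function v" and t: "fst t \<noteq> 0" "snd t \<noteq> 0"
    and [measurable]: "g \<in> borel_measurable borel"
  shows "(\<integral>\<^sup>+x. g (coord_divide x t) * v x \<partial>lebesgue)
    \<le> ennreal \<bar>fst t * snd t\<bar> * (dilation_ratio v t * (\<integral>\<^sup>+y. g y * v y \<partial>lebesgue))"
proof -
  from v have "v \<in> borel_measurable (completion lborel)" by (simp add: weight_function_def)
  then obtain u where [measurable]: "u \<in> borel_measurable lborel" and u: "AE x in lborel. v x = u x"
    using completion_ex_borel_measurable by blast
  have v_pos: "AE x in lborel. 0 < v x \<and> v x < top"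
    using v by (simp add: weight_function_def AE_completion_iff)
  have "(\<integral>\<^sup>+x. g (coord_divide x t) * v x \<partial>lebesgue) = (\<integral>\<^sup>+x. g (coord_divide x t) * u x \<partial>lborel)"
    unfolding nn_integral_completion
    by (intro nn_integral_cong_AE) (use u in eventually_elim, simp)
  also have "\<dots> = ennreal \<bar>fst t * snd t\<bar> * (\<integral>\<^sup>+y. g y * u (dilate t y) \<partial>lborel)"
    using t by (subst nn_integral_dilate[of _ t]) (auto simp: coord_divide_dilate)
  also have "(\<integral>\<^sup>+y. g y * u (dilate t y) \<partial>lborel) \<le> (\<integral>\<^sup>+y. dilation_ratio v t * (g y * u y) \<partial>lborel)"
  proof (rule nn_integral_mono_AE)
    have "AE y in lebesgue. v (dilate t y) = u (dilate t y)"
      using u by (intro AE_dilate t AE_completion)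
    then have "AE y in lborel. v (dilate t y) = u (dilate t y)"
      by (simp add: AE_completion_iff)
    with u v_pos
    show "AE y in lborel. g y * u (dilate t y) \<le> dilation_ratio v t * (g y * u y)"
    proof eventually_elim
      case (elim y)
      then have "g y * v (dilate t y) \<le> g y * (dilation_ratio v t * v y)"
        by (intro mult_left_mono weight_dilate_le) auto
      with elim show ?case by (simp add: mult_ac)
    qed
  qed
  also have "\<dots> = dilation_ratio v t * (\<integral>\<^sup>+y. g y * u y \<partial>lborel)"
    by (simp add: nn_integral_cmult)
  also have "(\<integral>\<^sup>+y. g y * u y \<partial>lborel) = (\<integral>\<^sup>+y. g y * v y \<partial>lebesgue)"
    unfolding nn_integral_completion
    by (intro nn_integral_cong_AE) (use u in eventually_elim, simp)
  finally show ?thesis by (simp add: mult_left_mono)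
qed

section \<open>The weighted estimate for multiplicative convolutions\<close>

text \<open>Monotonicity of the integral needs no measurability, whereas pulling a constant out of it does.
  Hence the constant is moved to the side of the measurable function \<open>f\<close> first; then \<open>g\<close> may be
  arbitrary, its integral being a lower integral.\<close>

lemma nn_integral_le_lower_integral:
  fixes f g :: "'a \<Rightarrow> ennreal"
  assumes [measurable]: "f \<in> borel_measurable M" and c: "c < top"
    and le: "AE t in M. f t \<le> g t * c"
  shows "(\<integral>\<^sup>+t. f t \<partial>M) \<le> (\<integral>\<^sup>+t. g t \<partial>M) * c"
proof (cases "c = 0")
  case True
  with le have "AE t in M. f t = 0" by simp
  then show ?thesis using True by (simp add: nn_integral_0_iff_AE)
next
  case False
  have cancel: "a / c * c = a" for a :: ennreal
    using False c by (simp add: ennreal_divide_times ennreal_times_divide)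
  have "(\<integral>\<^sup>+t. f t / c \<partial>M) \<le> (\<integral>\<^sup>+t. g t \<partial>M)"
  proof (rule nn_integral_mono_AE)
    show "AE t in M. f t / c \<le> g t"
      using le
    proof eventually_elim
      case (elim t)
      then have "f t / c \<le> g t * c / c" by (rule divide_right_mono_ennreal)
      also have "\<dots> = g t" using cancel by (metis ennreal_divide_times ennreal_times_divide)
      finally show ?case .
    qed
  qed
  then have "(\<integral>\<^sup>+t. f t / c \<partial>M) * c \<le> (\<integral>\<^sup>+t. g t \<partial>M) * c" by (rule mult_right_mono) simp
  then show ?thesis by (simp add: nn_integral_divide cancel)
qed

text \<open>Minkowski's inequality for \<open>F x t = k t * h (x / t) * v x powr (1 / p)\<close>, which absorbs the
  weight into the integrand. The norm of \<open>F _ t\<close> is measurable in \<open>t\<close> and lies below the integrand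
  on the right-hand side, which need not be measurable.\<close>

lemma multiplicative_convolution_bound:
  fixes k h :: "real \<times> real \<Rightarrow> ennreal"
  assumes p: "1 < p" and v: "weight_function v"
    and k [measurable]: "k \<in> borel_measurable borel" and h [measurable]: "h \<in> borel_measurable borel"
    and fin: "(\<integral>\<^sup>+y. ennreal_powr (h y) p * v y \<partial>lebesgue) < top"
  shows "(\<integral>\<^sup>+x. ennreal_powr (\<integral>\<^sup>+t. k t * h (coord_divide x t) \<partial>lebesgue) p * v x \<partial>lebesgue)
    \<le> ennreal_powr ((\<integral>\<^sup>+t. k t * ennreal (\<bar>fst t * snd t\<bar> powr (1 / p))
            * ennreal_powr (dilation_ratio v t) (1 / p) \<partial>lebesgue)
        * ennreal_powr (\<integral>\<^sup>+y. ennreal_powr (h y) p * v y \<partial>lebesgue) (1 / p)) p"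
proof -
  from v have "v \<in> borel_measurable (completion lborel)" by (simp add: weight_function_def)
  then obtain u where [measurable]: "u \<in> borel_measurable lborel" and u: "AE x in lborel. v x = u x"
    using completion_ex_borel_measurable by blast
  define S where "S = ennreal_powr (\<integral>\<^sup>+y. ennreal_powr (h y) p * v y \<partial>lebesgue) (1 / p)"
  have p_inv: "ennreal_powr (ennreal_powr a (1 / p)) p = a" "ennreal_powr (ennreal_powr a p) (1 / p) = a" for a
    using p by (simp_all add: ennreal_powr_powr)
  define F where "F x t = k t * h (coord_divide x t) * ennreal_powr (u x) (1 / p)" for x t
  have F [measurable]: "case_prod F \<in> borel_measurable (lborel \<Otimes>\<^sub>M lborel)"
    unfolding F_def by measurable
  have F_powr: "ennreal_powr (F x t) p = ennreal_powr (k t) p * (ennreal_powr (h (coord_divide x t)) p * u x)" for x t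
    by (simp add: F_def ennreal_powr_mult p_inv mult_ac)
  have "(\<integral>\<^sup>+x. ennreal_powr (\<integral>\<^sup>+t. k t * h (coord_divide x t) \<partial>lebesgue) p * v x \<partial>lebesgue)
      = (\<integral>\<^sup>+x. ennreal_powr (\<integral>\<^sup>+t. F x t \<partial>lborel) p \<partial>lborel)"
    unfolding nn_integral_completion
    by (intro nn_integral_cong_AE)
      (use u in eventually_elim, simp add: F_def nn_integral_multc ennreal_powr_mult p_inv)
  also have "\<dots> \<le> ennreal_powr
      (\<integral>\<^sup>+t. ennreal_powr (\<integral>\<^sup>+x. ennreal_powr (F x t) p \<partial>lborel) (1 / p) \<partial>lborel) p"
    by (intro Minkowski_nn_integral p F lborel.sigma_finite_measure_axioms)
  also have "\<dots> \<le> ennreal_powr ((\<integral>\<^sup>+t. k t * ennreal (\<bar>fst t * snd t\<bar> powr (1 / p))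
            * ennreal_powr (dilation_ratio v t) (1 / p) \<partial>lborel) * S) p"
  proof (intro ennreal_powr_mono nn_integral_le_lower_integral)
    have "AE t in lborel. fst t \<noteq> 0 \<and> snd (t :: real \<times> real) \<noteq> 0"
      using AE_off_axes by (simp add: AE_completion_iff)
    then show "AE t in lborel. ennreal_powr (\<integral>\<^sup>+x. ennreal_powr (F x t) p \<partial>lborel) (1 / p)
        \<le> k t * ennreal (\<bar>fst t * snd t\<bar> powr (1 / p)) * ennreal_powr (dilation_ratio v t) (1 / p) * S"
    proof eventually_elim
      case (elim t)
      have "(\<integral>\<^sup>+x. ennreal_powr (F x t) p \<partial>lborel)
          = ennreal_powr (k t) p * (\<integral>\<^sup>+x. ennreal_powr (h (coord_divide x t)) p * u x \<partial>lborel)"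
        unfolding F_powr by (simp add: nn_integral_cmult)
      also have "(\<integral>\<^sup>+x. ennreal_powr (h (coord_divide x t)) p * u x \<partial>lborel)
          = (\<integral>\<^sup>+x. ennreal_powr (h (coord_divide x t)) p * v x \<partial>lebesgue)"
        unfolding nn_integral_completion
        by (intro nn_integral_cong_AE) (use u in eventually_elim, simp)
      also have "\<dots> \<le> ennreal \<bar>fst t * snd t\<bar>
          * (dilation_ratio v t * (\<integral>\<^sup>+y. ennreal_powr (h y) p * v y \<partial>lebesgue))"
        using elim by (intro nn_integral_coord_divide_le v) auto
      finally have "ennreal_powr (\<integral>\<^sup>+x. ennreal_powr (F x t) p \<partial>lborel) (1 / p)
        \<le> ennreal_powr (ennreal_powr (k t) p * (ennreal \<bar>fst t * snd t\<bar>
          * (dilation_ratio v t * (\<integral>\<^sup>+y. ennreal_powr (h y) p * v y \<partial>lebesgue)))) (1 / p)"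
        using p by (intro ennreal_powr_mono) (auto simp: mult_left_mono)
      then show ?case
        by (simp add: ennreal_powr_mult p_inv ennreal_powr_ennreal S_def mult_ac)
    qed
  qed (use p fin in \<open>auto simp: S_def\<close>)
  finally show ?thesis by (simp add: nn_integral_completion S_def)
qed

section \<open>Measurability of the Dunkl-Hausdorff integrand\<close>

lemma completion_ex_borel_measurable_complex:
  fixes g :: "'a \<Rightarrow> complex"
  assumes g: "g \<in> borel_measurable (completion M)"
  shows "\<exists>g' \<in> borel_measurable M. AE x in M. g x = g' x"
proof -
  have "(\<lambda>x. Re (g x)) \<in> borel_measurable (completion M)"
      "(\<lambda>x. Im (g x)) \<in> borel_measurable (completion M)"
    using g by simp_all
  from this[THEN completion_ex_borel_measurable_real] obtain a b
    where [measurable]: "a \<in> borel_measurable M" "b \<in> borel_measurable M"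
      and ab: "AE x in M. Re (g x) = a x" "AE x in M. Im (g x) = b x"
    by blast
  have "(\<lambda>x. Complex (a x) (b x)) \<in> borel_measurable M"
    unfolding Complex_eq by measurable
  moreover have "AE x in M. g x = Complex (a x) (b x)"
    using ab by eventually_elim (simp add: complex_eq_iff)
  ultimately show ?thesis by (intro bexI[of _ "\<lambda>x. Complex (a x) (b x)"])
qed

lemma integrand_eq:
  "dunkl_hausdorff_integrand \<alpha> \<phi> f x t
    = of_real (cmod (\<phi> t) / \<bar>fst t * snd t\<bar> powr (2 * \<alpha> + 2)) * f (coord_divide x t)"
  by (cases x; cases t) (simp add: dunkl_hausdorff_integrand_def coord_divide_def)

text \<open>Off the axes the power of \<open>t1 * t2\<close> in \<open>A_sup\<close> splits into the one of the kernel and the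
  factor \<open>\<bar>t1 * t2\<bar> powr (1 / p)\<close>, which is the \<open>p\<close>-th root of the Jacobian of the dilation.\<close>

lemma A_sup_eq:
  "A_sup \<alpha> p v \<phi> = (\<integral>\<^sup>+t. ennreal (cmod (\<phi> t) / \<bar>fst t * snd t\<bar> powr (2 * \<alpha> + 2))
      * ennreal (\<bar>fst t * snd t\<bar> powr (1 / p)) * ennreal_powr (dilation_ratio v t) (1 / p) \<partial>lebesgue)"
  unfolding A_sup_def
proof (intro nn_integral_cong_AE)
  show "AE t in lebesgue. (case t of (t1, t2) \<Rightarrow>
        ennreal (cmod (\<phi> (t1, t2)) / \<bar>t1 * t2\<bar> powr (2 * \<alpha> + 2 - 1 / p)) *
        ennreal_powr (SUP (y1, y2) \<in> UNIV. v (t1 * y1, t2 * y2) / v (y1, y2)) (1 / p))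
    = ennreal (cmod (\<phi> t) / \<bar>fst t * snd t\<bar> powr (2 * \<alpha> + 2))
      * ennreal (\<bar>fst t * snd t\<bar> powr (1 / p)) * ennreal_powr (dilation_ratio v t) (1 / p)"
    using AE_off_axes
  proof eventually_elim
    case (elim t)
    obtain t1 t2 where t: "t = (t1, t2)" by (cases t)
    have "(SUP (y1, y2) \<in> UNIV. v (t1 * y1, t2 * y2) / v (y1, y2)) = dilation_ratio v t"
      by (simp add: dilation_ratio_def dilate_def t case_prod_beta)
    moreover have "ennreal (cmod (\<phi> t) / \<bar>t1 * t2\<bar> powr (2 * \<alpha> + 2 - 1 / p))
        = ennreal (cmod (\<phi> t) / \<bar>t1 * t2\<bar> powr (2 * \<alpha> + 2)) * ennreal (\<bar>t1 * t2\<bar> powr (1 / p))"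
      using elim by (subst ennreal_mult[symmetric]) (auto simp: t powr_diff)
    ultimately show ?case by (simp add: t)
  qed
qed

lemma Lp_norm_powr:
  "0 < p \<Longrightarrow> ennreal_powr (Lp_norm p v f) p = (\<integral>\<^sup>+x. ennreal_powr (ennreal (cmod (f x))) p * v x \<partial>lebesgue)"
  by (simp add: Lp_norm_def ennreal_powr_powr ennreal_powr_ennreal)

text \<open>Fubini's theorem needs an integrand that is jointly measurable in \<open>x\<close> and \<open>t\<close>, which is the
  case when \<open>f\<close> and \<open>\<phi>\<close> are Borel functions. For almost every \<open>x\<close>, passing to Borel versions
  changes the integrand on a null set of \<open>t\<close> only, because \<open>t \<mapsto> x / t\<close> pulls null sets back to
  null sets when \<open>x\<close> lies off the axes.\<close>

lemma Borel_versions: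
  assumes f: "f \<in> borel_measurable lebesgue" and \<phi>: "\<phi> \<in> borel_measurable lebesgue"
  obtains g \<psi> :: "real \<times> real \<Rightarrow> complex" where
    "g \<in> borel_measurable borel" "\<psi> \<in> borel_measurable borel"
    "AE x in lebesgue. f x = g x" "AE t in lebesgue. \<phi> t = \<psi> t"
    "AE x in lebesgue. AE t in lebesgue.
      dunkl_hausdorff_integrand \<alpha> \<phi> f x t = dunkl_hausdorff_integrand \<alpha> \<psi> g x t"
proof -
  obtain g \<psi> where m: "g \<in> borel_measurable lborel" "\<psi> \<in> borel_measurable lborel"
    and ae: "AE x in lborel. f x = g x" "AE t in lborel. \<phi> t = \<psi> t"
    using f[THEN completion_ex_borel_measurable_complex] \<phi>[THEN completion_ex_borel_measurable_complex]
    by blast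
  have ae': "AE x in lebesgue. f x = g x" "AE t in lebesgue. \<phi> t = \<psi> t"
    using ae by (auto intro: AE_completion)
  have "AE x in lebesgue. AE t in lebesgue.
      dunkl_hausdorff_integrand \<alpha> \<phi> f x t = dunkl_hausdorff_integrand \<alpha> \<psi> g x t"
    using AE_off_axes
  proof eventually_elim
    case (elim x)
    then have "AE t in lebesgue. f (coord_divide x t) = g (coord_divide x t)"
      using ae' by (intro AE_coord_divide) auto
    with ae'(2) show ?case by eventually_elim (simp add: integrand_eq)
  qed
  then show thesis using m ae' by (intro that) simp_all
qed

lemma measurable_dunkl_hausdorff_integrand:
  assumes [measurable]: "f \<in> borel_measurable borel" "\<phi> \<in> borel_measurable borel"
  shows "(\<lambda>(x, t). dunkl_hausdorff_integrand \<alpha> \<phi> f x t) \<in> borel_measurable (borel \<Otimes>\<^sub>M borel)"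
proof -
  have [measurable]: "fst \<in> borel_measurable (borel :: (real \<times> real) measure)"
      "snd \<in> borel_measurable (borel :: (real \<times> real) measure)"
    by (simp_all flip: borel_prod)
  show ?thesis unfolding integrand_eq by measurable
qed

lemma AE_measurable_dunkl_hausdorff_integrand:
  assumes "f \<in> borel_measurable lebesgue" "\<phi> \<in> borel_measurable lebesgue"
  shows "AE x in lebesgue. dunkl_hausdorff_integrand \<alpha> \<phi> f x \<in> borel_measurable lebesgue"
proof -
  obtain g \<psi> where m: "g \<in> borel_measurable borel" "\<psi> \<in> borel_measurable borel"
    and eq: "AE x in lebesgue. AE t in lebesgue.
      dunkl_hausdorff_integrand \<alpha> \<phi> f x t = dunkl_hausdorff_integrand \<alpha> \<psi> g x t"
    by (rule Borel_versions[OF assms]) (rule that; assumption)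
  note [measurable] = measurable_dunkl_hausdorff_integrand[OF m, of \<alpha>]
  from eq show ?thesis
  proof eventually_elim
    case (elim x)
    have "dunkl_hausdorff_integrand \<alpha> \<psi> g x \<in> borel_measurable lborel" by measurable
    then have "dunkl_hausdorff_integrand \<alpha> \<psi> g x \<in> borel_measurable lebesgue"
      by (rule measurable_completion)
    then show ?case by (rule borel_measurable_AE) (use elim in eventually_elim, simp)
  qed
qed

lemma measurable_dunkl_hausdorff:
  assumes "f \<in> borel_measurable lebesgue" "\<phi> \<in> borel_measurable lebesgue"
  shows "dunkl_hausdorff \<alpha> \<phi> f \<in> borel_measurable lebesgue"
proof -
  obtain g \<psi> where m: "g \<in> borel_measurable borel" "\<psi> \<in> borel_measurable borel"
    and eq: "AE x in lebesgue. AE t in lebesgue.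
      dunkl_hausdorff_integrand \<alpha> \<phi> f x t = dunkl_hausdorff_integrand \<alpha> \<psi> g x t"
    by (rule Borel_versions[OF assms]) (rule that; assumption)
  note [measurable] = measurable_dunkl_hausdorff_integrand[OF m, of \<alpha>]
  have "(\<lambda>x. LINT t|lborel. dunkl_hausdorff_integrand \<alpha> \<psi> g x t) \<in> borel_measurable lborel"
    by measurable
  then have "(\<lambda>x. LINT t|lborel. dunkl_hausdorff_integrand \<alpha> \<psi> g x t) \<in> borel_measurable lebesgue"
    by (rule measurable_completion)
  then show ?thesis
  proof (rule borel_measurable_AE)
    show "AE x in lebesgue. (LINT t|lborel. dunkl_hausdorff_integrand \<alpha> \<psi> g x t)
        = dunkl_hausdorff \<alpha> \<phi> f x"
      using eq AE_measurable_dunkl_hausdorff_integrand[OF assms, of \<alpha>]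
    proof eventually_elim
      case (elim x)
      have *: "dunkl_hausdorff_integrand \<alpha> \<psi> g x \<in> borel_measurable lborel" by measurable
      then have "(LINT t|lborel. dunkl_hausdorff_integrand \<alpha> \<psi> g x t)
          = (LINT t|lebesgue. dunkl_hausdorff_integrand \<alpha> \<psi> g x t)"
        by (rule integral_completion[symmetric])
      also have "\<dots> = dunkl_hausdorff \<alpha> \<phi> f x"
        unfolding dunkl_hausdorff_def
        using elim measurable_completion[OF *] by (intro integral_cong_AE) auto
      finally show ?case .
    qed
  qed
qed

section \<open>Boundedness of the Dunkl-Hausdorff operator\<close>

text \<open>The norm estimate for the integral of the absolute value of the integrand. It is stated before
  anything is known about integrability, which will be a consequence.\<close>

lemma dunkl_hausdorff_nn_bound:
  assumes p: "1 < p" and v: "weight_function v" and \<phi>: "\<phi> \<in> borel_measurable lebesgue"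
    and f: "f \<in> Lp_space p v"
  shows "(\<integral>\<^sup>+x. ennreal_powr
        (\<integral>\<^sup>+t. ennreal (cmod (dunkl_hausdorff_integrand \<alpha> \<phi> f x t)) \<partial>lebesgue) p * v x \<partial>lebesgue)
    \<le> ennreal_powr (A_sup \<alpha> p v \<phi> * Lp_norm p v f) p"
proof -
  have fm: "f \<in> borel_measurable lebesgue" and fin: "Lp_norm p v f < top"
    using f by (auto simp: Lp_space_def)
  obtain g \<psi> where m [measurable]: "g \<in> borel_measurable borel" "\<psi> \<in> borel_measurable borel"
    and ae: "AE x in lebesgue. f x = g x" "AE t in lebesgue. \<phi> t = \<psi> t"
    and eq: "AE x in lebesgue. AE t in lebesgue.
      dunkl_hausdorff_integrand \<alpha> \<phi> f x t = dunkl_hausdorff_integrand \<alpha> \<psi> g x t"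
    by (rule Borel_versions[OF fm \<phi>]) (rule that; assumption)
  have [measurable]: "fst \<in> borel_measurable (borel :: (real \<times> real) measure)"
      "snd \<in> borel_measurable (borel :: (real \<times> real) measure)"
    by (simp_all flip: borel_prod)
  define k where "k t = ennreal (cmod (\<psi> t) / \<bar>fst t * snd t\<bar> powr (2 * \<alpha> + 2))" for t
  define h where "h y = ennreal (cmod (g y))" for y
  have [measurable]: "k \<in> borel_measurable borel" "h \<in> borel_measurable borel"
    unfolding k_def h_def by measurable
  have kh: "ennreal (cmod (dunkl_hausdorff_integrand \<alpha> \<psi> g x t)) = k t * h (coord_divide x t)" for x t
    by (simp add: integrand_eq k_def h_def norm_mult norm_divide flip: ennreal_mult)
  have norm: "(\<integral>\<^sup>+y. ennreal_powr (h y) p * v y \<partial>lebesgue) = ennreal_powr (Lp_norm p v f) p"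
    using p ae(1) unfolding h_def
    by (subst Lp_norm_powr) (auto intro!: nn_integral_cong_AE)
  have A: "A_sup \<alpha> p v \<phi> = (\<integral>\<^sup>+t. k t * ennreal (\<bar>fst t * snd t\<bar> powr (1 / p))
      * ennreal_powr (dilation_ratio v t) (1 / p) \<partial>lebesgue)"
    unfolding A_sup_eq k_def by (intro nn_integral_cong_AE) (use ae(2) in eventually_elim, simp)
  have "(\<integral>\<^sup>+x. ennreal_powr
        (\<integral>\<^sup>+t. ennreal (cmod (dunkl_hausdorff_integrand \<alpha> \<phi> f x t)) \<partial>lebesgue) p * v x \<partial>lebesgue)
      = (\<integral>\<^sup>+x. ennreal_powr (\<integral>\<^sup>+t. k t * h (coord_divide x t) \<partial>lebesgue) p * v x \<partial>lebesgue)"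
  proof (intro nn_integral_cong_AE)
    show "AE x in lebesgue. ennreal_powr
        (\<integral>\<^sup>+t. ennreal (cmod (dunkl_hausdorff_integrand \<alpha> \<phi> f x t)) \<partial>lebesgue) p * v x
      = ennreal_powr (\<integral>\<^sup>+t. k t * h (coord_divide x t) \<partial>lebesgue) p * v x"
      using eq
    proof eventually_elim
      case (elim x)
      then have "(\<integral>\<^sup>+t. ennreal (cmod (dunkl_hausdorff_integrand \<alpha> \<phi> f x t)) \<partial>lebesgue)
          = (\<integral>\<^sup>+t. k t * h (coord_divide x t) \<partial>lebesgue)"
        by (intro nn_integral_cong_AE, eventually_elim) (simp flip: kh)
      then show ?case by simp
    qed
  qed
  also have "\<dots> \<le> ennreal_powr (A_sup \<alpha> p v \<phi> * ennreal_powr (ennreal_powr (Lp_norm p v f) p) (1 / p)) p"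
    unfolding A norm[symmetric]
    using fin by (intro multiplicative_convolution_bound p v) (auto simp: norm)
  also have "ennreal_powr (ennreal_powr (Lp_norm p v f) p) (1 / p) = Lp_norm p v f"
    using p by (simp add: ennreal_powr_powr)
  finally show ?thesis .
qed

text \<open>By the preceding bound, the \<open>p\<close>-th power of the integral of the absolute value, times \<open>v\<close>,
  has finite integral, hence is finite almost everywhere; since \<open>v > 0\<close> almost everywhere, so
  is the integral itself.\<close>

lemma integrable_dunkl_hausdorff_integrand:
  assumes p: "1 < p" and v: "weight_function v" and \<phi>: "\<phi> \<in> borel_measurable lebesgue"
    and A: "A_sup \<alpha> p v \<phi> < top" and f: "f \<in> Lp_space p v"
  shows "AE x in lebesgue. integrable lebesgue (dunkl_hausdorff_integrand \<alpha> \<phi> f x)"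
proof -
  have fm: "f \<in> borel_measurable lebesgue" and fin: "Lp_norm p v f < top"
    using f by (auto simp: Lp_space_def)
  let ?G = "\<lambda>x. \<integral>\<^sup>+t. ennreal (cmod (dunkl_hausdorff_integrand \<alpha> \<phi> f x t)) \<partial>lebesgue"
  obtain g \<psi> where m [measurable]: "g \<in> borel_measurable borel" "\<psi> \<in> borel_measurable borel"
    and eq: "AE x in lebesgue. AE t in lebesgue.
      dunkl_hausdorff_integrand \<alpha> \<phi> f x t = dunkl_hausdorff_integrand \<alpha> \<psi> g x t"
    by (rule Borel_versions[OF fm \<phi>]) (rule that; assumption)
  note [measurable] = measurable_dunkl_hausdorff_integrand[OF m, of \<alpha>]
  have [measurable]: "v \<in> borel_measurable lebesgue" using v by (simp add: weight_function_def)
  \<comment> \<open>That a function with finite integral is finite almost everywhere requires measurability,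
    which \<open>?G\<close> inherits from the integral for the Borel versions.\<close>
  let ?H = "\<lambda>x. \<integral>\<^sup>+t. ennreal (cmod (dunkl_hausdorff_integrand \<alpha> \<psi> g x t)) \<partial>lborel"
  have [measurable]: "?H \<in> borel_measurable lebesgue"
    by (intro measurable_completion) measurable
  have GH: "AE x in lebesgue. ?G x = ?H x"
    unfolding nn_integral_completion using eq
    by eventually_elim (auto intro!: nn_integral_cong_AE simp: AE_completion_iff)
  have "(\<integral>\<^sup>+x. ennreal_powr (?H x) p * v x \<partial>lebesgue) = (\<integral>\<^sup>+x. ennreal_powr (?G x) p * v x \<partial>lebesgue)"
    by (intro nn_integral_cong_AE) (use GH in eventually_elim, simp)
  also have "\<dots> \<le> ennreal_powr (A_sup \<alpha> p v \<phi> * Lp_norm p v f) p"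
    by (intro dunkl_hausdorff_nn_bound p v \<phi> f)
  also have "\<dots> < top" using A fin by (simp add: ennreal_mult_less_top)
  finally have "AE x in lebesgue. ennreal_powr (?H x) p * v x \<noteq> top"
    using nn_integral_PInf_AE[of "\<lambda>x. ennreal_powr (?H x) p * v x" lebesgue]
    by (simp add: less_top)
  moreover have "AE x in lebesgue. 0 < v x" using v by (auto simp: weight_function_def)
  ultimately show ?thesis
    using GH AE_measurable_dunkl_hausdorff_integrand[OF fm \<phi>, of \<alpha>]
  proof eventually_elim
    case (elim x)
    then have "ennreal_powr (?G x) p * v x \<noteq> top" "v x \<noteq> 0" by simp_all
    then have "ennreal_powr (?G x) p \<noteq> top" by (auto simp: ennreal_mult_eq_top_iff)
    then have "?G x \<noteq> top" by simp
    with elim show ?case by (intro integrableI_bounded) (auto simp: less_top)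
  qed
qed

lemma Lp_norm_dunkl_hausdorff_le:
  assumes p: "1 < p" and v: "weight_function v" and \<phi>: "\<phi> \<in> borel_measurable lebesgue"
    and A: "A_sup \<alpha> p v \<phi> < top" and f: "f \<in> Lp_space p v"
  shows "Lp_norm p v (dunkl_hausdorff \<alpha> \<phi> f) \<le> A_sup \<alpha> p v \<phi> * Lp_norm p v f"
proof -
  have "ennreal_powr (Lp_norm p v (dunkl_hausdorff \<alpha> \<phi> f)) p
    = (\<integral>\<^sup>+x. ennreal_powr (ennreal (cmod (dunkl_hausdorff \<alpha> \<phi> f x))) p * v x \<partial>lebesgue)"
    using p by (intro Lp_norm_powr) auto
  also have "\<dots> \<le> (\<integral>\<^sup>+x. ennreal_powr
        (\<integral>\<^sup>+t. ennreal (cmod (dunkl_hausdorff_integrand \<alpha> \<phi> f x t)) \<partial>lebesgue) p * v x \<partial>lebesgue)"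
  proof (rule nn_integral_mono_AE)
    show "AE x in lebesgue. ennreal_powr (ennreal (cmod (dunkl_hausdorff \<alpha> \<phi> f x))) p * v x
      \<le> ennreal_powr
        (\<integral>\<^sup>+t. ennreal (cmod (dunkl_hausdorff_integrand \<alpha> \<phi> f x t)) \<partial>lebesgue) p * v x"
      using integrable_dunkl_hausdorff_integrand[OF assms]
    proof eventually_elim
      case (elim x)
      then show ?case
        unfolding dunkl_hausdorff_def
        using p by (intro mult_right_mono ennreal_powr_mono integral_norm_bound_ennreal) auto
    qed
  qed
  also have "\<dots> \<le> ennreal_powr (A_sup \<alpha> p v \<phi> * Lp_norm p v f) p"
    by (intro dunkl_hausdorff_nn_bound p v \<phi> f)
  finally have "ennreal_powr (ennreal_powr (Lp_norm p v (dunkl_hausdorff \<alpha> \<phi> f)) p) (1 / p)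
      \<le> ennreal_powr (ennreal_powr (A_sup \<alpha> p v \<phi> * Lp_norm p v f) p) (1 / p)"
    by (rule ennreal_powr_mono) (use p in simp)
  then show ?thesis using p by (simp add: ennreal_powr_powr)
qed

theorem theorem3p2:
  fixes \<alpha> p :: real
    and v :: "real \<times> real \<Rightarrow> ennreal"
    and \<phi> :: "real \<times> real \<Rightarrow> complex"
  assumes "1 < p"
    and "weight_function v"
    and "integrable lebesgue \<phi>"
    and "A_sup \<alpha> p v \<phi> < \<infinity>"
  shows "(\<forall>f \<in> Lp_space p v.
            AE x in lebesgue. integrable lebesgue (dunkl_hausdorff_integrand \<alpha> \<phi> f x))
       \<and> bounded_operator_Lp p v (dunkl_hausdorff \<alpha> \<phi>)
       \<and> (\<forall>f \<in> Lp_space p v.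
            Lp_norm p v (dunkl_hausdorff \<alpha> \<phi> f) \<le> A_sup \<alpha> p v \<phi> * Lp_norm p v f)"
proof -
  let ?T = "dunkl_hausdorff \<alpha> \<phi>"
  have \<phi>: "\<phi> \<in> borel_measurable lebesgue" using assms(3) by auto
  have A: "A_sup \<alpha> p v \<phi> < top" using assms(4) by simp
  have int: "AE x in lebesgue. integrable lebesgue (dunkl_hausdorff_integrand \<alpha> \<phi> f x)"
    if "f \<in> Lp_space p v" for f
    using integrable_dunkl_hausdorff_integrand[OF assms(1,2) \<phi> A that] .
  have bound: "Lp_norm p v (?T f) \<le> A_sup \<alpha> p v \<phi> * Lp_norm p v f" if "f \<in> Lp_space p v" for f
    using Lp_norm_dunkl_hausdorff_le[OF assms(1,2) \<phi> A that] .
  have "bounded_operator_Lp p v ?T"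
    unfolding bounded_operator_Lp_def
  proof (intro conjI ballI allI impI)
    fix f assume f: "f \<in> Lp_space p v"
    have "A_sup \<alpha> p v \<phi> * Lp_norm p v f < top"
      using A f by (simp add: Lp_space_def ennreal_mult_less_top)
    then show "?T f \<in> Lp_space p v"
      using bound[OF f] measurable_dunkl_hausdorff[of f \<phi> \<alpha>] f \<phi>
      by (auto simp: Lp_space_def intro: le_less_trans)
  next
    fix f g assume fg: "f \<in> Lp_space p v" "g \<in> Lp_space p v" "AE x in lebesgue. f x = g x"
    show "AE x in lebesgue. ?T f x = ?T g x"
      using AE_off_axes int[OF fg(1)] int[OF fg(2)]
    proof eventually_elim
      case (elim x)
      then have "AE t in lebesgue. f (coord_divide x t) = g (coord_divide x t)"
        by (intro AE_coord_divide fg) auto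
      then show ?case
        unfolding dunkl_hausdorff_def using elim
        by (intro integral_cong_AE) (auto simp: integrand_eq)
    qed
  next
    fix f g assume fg: "f \<in> Lp_space p v" "g \<in> Lp_space p v"
    show "AE x in lebesgue. ?T (\<lambda>y. f y + g y) x = ?T f x + ?T g x"
      using int[OF fg(1)] int[OF fg(2)]
    proof eventually_elim
      case (elim x)
      have "dunkl_hausdorff_integrand \<alpha> \<phi> (\<lambda>y. f y + g y) x
          = (\<lambda>t. dunkl_hausdorff_integrand \<alpha> \<phi> f x t + dunkl_hausdorff_integrand \<alpha> \<phi> g x t)"
        by (simp add: fun_eq_iff integrand_eq distrib_left add_divide_distrib)
      with elim show ?case by (simp add: dunkl_hausdorff_def)
    qed
  next
    fix c f
    have "dunkl_hausdorff_integrand \<alpha> \<phi> (\<lambda>y. c * f y) x t = c * dunkl_hausdorff_integrand \<alpha> \<phi> f x t" for x t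
      by (simp add: integrand_eq)
    then show "AE x in lebesgue. ?T (\<lambda>y. c * f y) x = c * ?T f x"
      by (simp add: dunkl_hausdorff_def)
  next
    show "\<exists>C\<ge>0. \<forall>f\<in>Lp_space p v. Lp_norm p v (?T f) \<le> ennreal C * Lp_norm p v f"
      using A bound by (intro exI[of _ "enn2real (A_sup \<alpha> p v \<phi>)"]) auto
  qed
  with int bound show ?thesis by blast
qed

end
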